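(* No large semi-walled wedge can be explored by a finite deterministic automaton with one pebble.
   Context: The oriented grid $\mathbb{Z}\times\mathbb{Z}$ is embedded in the plane (nodes at integer points, edges between nodes at distance 1); nodes are anonymous and every node has ports $N,E,S,W$ pointing North, East, South, West. Given two half-lines $H_1,H_2$ in the plane with a common origin $O$ (an arbitrary point; arbitrary real directions), let $W(H_1,H_2)$ be the closed region swept clockwise from $H_1$ to $H_2$ (half-lines included); the wedge is the subgraph of the grid induced by the grid nodes in $W(H_1,H_2)$. It is large if the clockwise angle $\alpha$ from $H_1$ to $H_2$ satisfies $\pi\le\alpha\le2\pi$. Consider grid edges $\{u,v\}$ with $u$ in the wedge, $v$ not in the wedge and $H_i$ meeting the closed segment $[u,v]$: $H_i$ is a wall if the ports of all such edges at $u$ and $v$ are blocked (cannot be taken), and free if they are free. A wedge is semi-walled if $H_1$ is a wall and $H_2$ is free; all other ports are free. The agent is a finite deterministic (Mealy) automaton carrying $p$ pebbles: at each step it sees which ports at the current node are free, whether a pebble lies there, and how many pebbles it carries; depending on its state and this input it moves through a free port, possibly dropping a pebble on the empty current node (if it carries one) or picking up the pebble lying there, and changes state. It starts in its initial state with all $p$ pebbles, no pebbles on the grid, at an adversarially chosen node of the wedge. An automaton explores the wedge if for every starting node in the wedge every node of the wedge is eventually visited. *)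

theory Defs
  imports "HOL-Analysis.Analysis"
begin

type_synonym node = "int \<times> int"

datatype port = North | East | South | West

fun neighbour :: "node \<Rightarrow> port \<Rightarrow> node" where
  "neighbour (x, y) North = (x, y + 1)"
| "neighbour (x, y) East = (x + 1, y)"
| "neighbour (x, y) South = (x, y - 1)"
| "neighbour (x, y) West = (x - 1, y)"

definition point :: "node \<Rightarrow> complex" where
  "point u = Complex (of_int (fst u)) (of_int (snd u))"

text \<open>
  A pair of half-lines with common origin is given by the origin \<open>c\<close>, the direction
  \<open>\<theta>\<close> of the first one (measured counterclockwise from East) and the clockwise angle
  \<open>\<alpha>\<close> from the first to the second one. Taking \<open>\<alpha>\<close> as a parameter separates
  the angles 0 and \<open>2 * pi\<close>, for which the two half-lines coincide.
\<close>

definition half_line :: "complex \<Rightarrow> real \<Rightarrow> complex set" where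
  "half_line c \<theta> = {c + rcis r \<theta> | r. 0 \<le> r}"

definition first_half_line :: "complex \<Rightarrow> real \<Rightarrow> real \<Rightarrow> complex set" where
  "first_half_line c \<theta> \<alpha> = half_line c \<theta>"

definition second_half_line :: "complex \<Rightarrow> real \<Rightarrow> real \<Rightarrow> complex set" where
  "second_half_line c \<theta> \<alpha> = half_line c (\<theta> - \<alpha>)"

definition region :: "complex \<Rightarrow> real \<Rightarrow> real \<Rightarrow> complex set" where
  "region c \<theta> \<alpha> = (\<Union>t\<in>{0..\<alpha>}. half_line c (\<theta> - t))"

definition wedge :: "complex \<Rightarrow> real \<Rightarrow> real \<Rightarrow> node set" where
  "wedge c \<theta> \<alpha> = {u. point u \<in> region c \<theta> \<alpha>}"

definition large :: "real \<Rightarrow> bool" where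
  "large \<alpha> \<longleftrightarrow> pi \<le> \<alpha> \<and> \<alpha> \<le> 2 * pi"

text \<open>An edge is the set of its two end nodes.\<close>

definition crossing_edges :: "node set \<Rightarrow> complex set \<Rightarrow> node set set" where
  "crossing_edges V H =
    {{u, v} | u v. u \<in> V \<and> v \<notin> V \<and> (\<exists>d. v = neighbour u d) \<and>
                   H \<inter> closed_segment (point u) (point v) \<noteq> {}}"

text \<open>
  \<open>B\<close> is the set of edges whose two ports are blocked. An edge that contains the
  origin can meet both half-lines (this happens in particular at every edge leaving the wedge
  from an origin that is itself a node), in which case a wall and a free half-line would impose
  contradictory conditions on it. The requirements on \<open>H\<close> therefore only concern the
  edges that do not also cross the other half-line \<open>H'\<close>; an edge crossing both may be
  blocked or free.
\<close>

definition is_wall :: "node set set \<Rightarrow> node set \<Rightarrow> complex set \<Rightarrow> complex set \<Rightarrow> bool" where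
  "is_wall B V H H' \<longleftrightarrow> (\<forall>e \<in> crossing_edges V H - crossing_edges V H'. e \<in> B)"

definition is_free :: "node set set \<Rightarrow> node set \<Rightarrow> complex set \<Rightarrow> complex set \<Rightarrow> bool" where
  "is_free B V H H' \<longleftrightarrow> (\<forall>e \<in> crossing_edges V H - crossing_edges V H'. e \<notin> B)"

definition semi_walled :: "node set set \<Rightarrow> complex \<Rightarrow> real \<Rightarrow> real \<Rightarrow> bool" where
  "semi_walled B c \<theta> \<alpha> \<longleftrightarrow>
    (let V = wedge c \<theta> \<alpha>;
         H1 = first_half_line c \<theta> \<alpha>;
         H2 = second_half_line c \<theta> \<alpha>
     in is_wall B V H1 H2 \<and> is_free B V H2 H1 \<and>
        (\<forall>e. e \<notin> crossing_edges V H1 \<union> crossing_edges V H2 \<longrightarrow> e \<notin> B))"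

definition free_ports :: "node set set \<Rightarrow> node \<Rightarrow> port set" where
  "free_ports B u = {d. {u, neighbour u d} \<notin> B}"

datatype pebble_action = Keep | Drop | Pick

text \<open>An input consists of the free ports at the current node, whether a pebble lies there,
  and the number of pebbles carried.\<close>

type_synonym observation = "port set \<times> bool \<times> nat"

record 's automaton =
  states :: "'s set"
  initial :: 's
  trans :: "'s \<Rightarrow> observation \<Rightarrow> 's \<times> pebble_action \<times> port"

text \<open>
  Only observations with at least one free port admit a legal move. In a large semi-walled
  wedge no node has all its ports blocked, since two opposite edges at a node cannot both
  cross the same half-line.
\<close>

definition pebble_automaton :: "nat \<Rightarrow> 's automaton \<Rightarrow> bool" where
  "pebble_automaton p M \<longleftrightarrow>
     finite (states M) \<and> initial M \<in> states M \<and>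
     (\<forall>q \<in> states M. \<forall>F b k. F \<noteq> {} \<and> k \<le> p \<longrightarrow>
        (case trans M q (F, b, k) of (q', a, d) \<Rightarrow>
           q' \<in> states M \<and> d \<in> F \<and>
           (a = Drop \<longrightarrow> \<not> b \<and> 0 < k) \<and>
           (a = Pick \<longrightarrow> b)))"

record 's config =
  pos :: node
  state :: 's
  pebbles :: "node set"
  carried :: nat

text \<open>The pebble action is performed at the current node, before the move.\<close>

definition step :: "'s automaton \<Rightarrow> node set set \<Rightarrow> 's config \<Rightarrow> 's config" where
  "step M B C =
    (let u = pos C; P = pebbles C; k = carried C in
     case trans M (state C) (free_ports B u, u \<in> P, k) of (q', a, d) \<Rightarrow>
       \<lparr>pos = neighbour u d,
        state = q',
        pebbles = (case a of Keep \<Rightarrow> P | Drop \<Rightarrow> insert u P | Pick \<Rightarrow> P - {u}),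
        carried = (case a of Keep \<Rightarrow> k | Drop \<Rightarrow> k - 1 | Pick \<Rightarrow> k + 1)\<rparr>)"

definition start :: "nat \<Rightarrow> 's automaton \<Rightarrow> node \<Rightarrow> 's config" where
  "start p M s = \<lparr>pos = s, state = initial M, pebbles = {}, carried = p\<rparr>"

definition explores :: "nat \<Rightarrow> 's automaton \<Rightarrow> node set set \<Rightarrow> node set \<Rightarrow> bool" where
  "explores p M B V \<longleftrightarrow>
    (\<forall>s \<in> V. \<forall>v \<in> V. \<exists>n. pos ((step M B ^^ n) (start p M s)) = v)"

end

theory Submission
  imports Defs
begin

text \<open>
  In a grid without walls the automaton, started with its pebble, stays within a bounded distance of
  a point moving with some constant velocity \<open>v\<close>. Blocked ports exist only next to
  \<open>H1\<close>. Inside the half-plane clockwise of \<open>H1\<close>, which belongs to the wedge,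
  there is a cone around directions nearly opposite to \<open>H1\<close>, so thin and so far from the
  boundary that no line parallel to \<open>v\<close> passes near both a point of the cone and
  \<open>H1\<close>. Started in the cone, the agent therefore never sees the wall, follows a single
  line, and misses most of the cone.
\<close>

section \<open>Configurations in the free grid\<close>

definition shift :: "node \<Rightarrow> 's config \<Rightarrow> 's config" where
  "shift w C = \<lparr>pos = pos C + w, state = state C, pebbles = (\<lambda>u. u + w) ` pebbles C,
                carried = carried C\<rparr>"

lemma shift_simps [simp]:
  "pos (shift w C) = pos C + w" "state (shift w C) = state C"
  "pebbles (shift w C) = (\<lambda>u. u + w) ` pebbles C" "carried (shift w C) = carried C"
  by (simp_all add: shift_def)

lemma neighbour_add: "neighbour (u + w) d = neighbour u d + w"
  by (cases u; cases w; cases d) auto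

lemma point_add: "point (u + w) = point u + point w"
  by (simp add: point_def complex_eq_iff)

lemma norm_neighbour: "norm (point (neighbour u d) - point u) = 1"
  by (cases u; cases d) (auto simp: point_def cmod_def)

lemma free_ports_empty [simp]: "free_ports {} u = UNIV"
  by (simp add: free_ports_def)

text \<open>Translation preserves whether the agent stands on a pebble, so at a node without blocked
  ports it observes exactly what it would observe in the free grid.\<close>

lemma step_shift:
  assumes "free_ports B (pos C + w) = UNIV"
  shows "step M B (shift w C) = shift w (step M {} C)"
proof -
  have m: "pos C + w \<in> (\<lambda>u. u + w) ` pebbles C \<longleftrightarrow> pos C \<in> pebbles C"
    by auto
  have i: "inj (\<lambda>u. u + w)"
    by (simp add: inj_on_def)
  obtain q a d where t: "trans M (state C) (UNIV, pos C \<in> pebbles C, carried C) = (q, a, d)"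
    by (metis prod_cases3)
  show ?thesis
    by (cases a) (simp_all add: step_def Let_def assms m t shift_def neighbour_add image_set_diff[OF i])
qed

text \<open>The hypothesis concerns only the run in the free grid, so a bound on that run suffices
  to check it. For \<open>B = {}\<close> it holds trivially, and free runs commute with
  translations.\<close>

lemma run_shift:
  assumes "\<And>m. free_ports B (pos ((step M {} ^^ m) C) + w) = UNIV"
  shows "(step M B ^^ n) (shift w C) = shift w ((step M {} ^^ n) C)"
  by (induction n) (simp_all add: assms step_shift)

section \<open>Invariants of runs with one pebble\<close>

definition legal :: "'s automaton \<Rightarrow> 's config \<Rightarrow> bool" where
  "legal M C \<longleftrightarrow> state C \<in> states M \<and>
     (carried C = 1 \<and> pebbles C = {} \<or> carried C = 0 \<and> (\<exists>P. pebbles C \<subseteq> {P}))"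

text \<open>Carrying counts as being at the pebble: in both cases the agent's position fixes where
  the pebble is.\<close>

definition at_pebble :: "'s config \<Rightarrow> bool" where
  "at_pebble C \<longleftrightarrow> carried C = 1 \<or> pos C \<in> pebbles C"

lemma legal_on_pebble:
  assumes "legal M C" "pos C \<in> pebbles C"
  shows "pebbles C = {pos C}" "carried C = 0"
  using assms unfolding legal_def by blast+

lemma legal_step:
  assumes M: "pebble_automaton 1 M" and C: "legal M C"
  shows "legal M (step M {} C)"
proof -
  obtain q a d where t: "trans M (state C) (UNIV, pos C \<in> pebbles C, carried C) = (q, a, d)"
    by (metis prod_cases3)
  have st: "state C \<in> states M" and "carried C \<le> 1"
    using C by (auto simp: legal_def)
  then have "q \<in> states M" "a = Drop \<Longrightarrow> pos C \<notin> pebbles C \<and> 0 < carried C"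
    "a = Pick \<Longrightarrow> pos C \<in> pebbles C"
    using bspec[OF conjunct2[OF conjunct2[OF M[unfolded pebble_automaton_def]]] st, rule_format,
        of UNIV "carried C" "pos C \<in> pebbles C"]
    by (simp_all add: t)
  moreover have "step M {} C = \<lparr>pos = neighbour (pos C) d, state = q,
      pebbles = (case a of Keep \<Rightarrow> pebbles C | Drop \<Rightarrow> insert (pos C) (pebbles C) | Pick \<Rightarrow> pebbles C - {pos C}),
      carried = (case a of Keep \<Rightarrow> carried C | Drop \<Rightarrow> carried C - 1 | Pick \<Rightarrow> carried C + 1)\<rparr>"
    by (simp add: step_def Let_def t)
  ultimately show ?thesis
    using C legal_on_pebble[OF C] by (cases a) (auto simp: legal_def)
qed

lemma legal_run:
  assumes "pebble_automaton 1 M" "legal M C"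
  shows "legal M ((step M {} ^^ n) C)"
  by (induction n) (simp_all add: assms(2) legal_step[OF assms(1)])

text \<open>Both agents carry nothing and stand on no pebble, so both observe
  \<open>(UNIV, False, 0)\<close>, wherever their pebbles lie.\<close>

lemma lone_step:
  assumes "legal M C" "legal M C'" "\<not> at_pebble C" "\<not> at_pebble C'"
    "state C' = state C" "pos C' = pos C + w"
  shows "state (step M {} C') = state (step M {} C) \<and> pos (step M {} C') = pos (step M {} C) + w"
proof -
  have "carried C = 0" "carried C' = 0" "pos C \<notin> pebbles C" "pos C' \<notin> pebbles C'"
    using assms by (auto simp: legal_def at_pebble_def)
  then show ?thesis
    using assms by (simp add: step_def Let_def neighbour_add split: prod.splits)
qed

lemma lone_run:
  assumes M: "pebble_automaton 1 M" and C: "legal M C" "legal M C'"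
    and "\<And>m. \<not> at_pebble ((step M {} ^^ m) C)" "\<And>m. \<not> at_pebble ((step M {} ^^ m) C')"
    and "state C' = state C" "pos C' = pos C + w"
  shows "state ((step M {} ^^ n) C') = state ((step M {} ^^ n) C) \<and>
         pos ((step M {} ^^ n) C') = pos ((step M {} ^^ n) C) + w"
  by (induction n) (simp_all add: assms(4-) lone_step[OF legal_run[OF M C(1)] legal_run[OF M C(2)]])

lemma at_pebble_shift:
  assumes "legal M C" "legal M C'" "at_pebble C" "at_pebble C'"
    "state C' = state C" "carried C' = carried C"
  shows "C' = shift (pos C' - pos C) C"
proof -
  have eq: "pebbles D = (if carried D = 1 then {} else {pos D})" if "legal M D" "at_pebble D" for D
    using that legal_on_pebble[of M D] unfolding legal_def at_pebble_def by (cases "carried D = 1") auto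
  have "pebbles C' = (\<lambda>u. u + (pos C' - pos C)) ` pebbles C"
    using assms eq[of C] eq[of C'] by simp
  then show ?thesis
    using assms by (simp add: shift_def)
qed

section \<open>Eventual periodicity and linear drift of free runs\<close>

lemma infinite_repetition:
  assumes "infinite (S :: nat set)" "finite A" "f ` S \<subseteq> A"
  obtains i j where "i \<in> S" "j \<in> S" "i < j" "f i = f j"
proof -
  have "\<not> inj_on f S"
    using assms by (meson finite_imageD finite_subset)
  then show ?thesis
    using that by (metis inj_onI linorder_neqE_nat)
qed

text \<open>At the pebble, the state and the number of carried pebbles determine the configuration up to
  translation. Once the agent never meets the pebble again, its state alone determines its moves.\<close>

lemma free_run_eventually_periodic:
  assumes M: "pebble_automaton 1 M" and C: "legal M C"
  defines "R \<equiv> \<lambda>n. (step M {} ^^ n) C"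
  obtains i \<tau> w where "0 < \<tau>" "\<And>n. i \<le> n \<Longrightarrow> pos (R (n + \<tau>)) = pos (R n) + w"
proof -
  have legal: "legal M (R n)" for n
    using legal_run[OF M C] by (simp add: R_def)
  have R_add: "(step M {} ^^ n) (R m) = R (m + n)" for m n
    by (simp add: R_def funpow_add add.commute[of m])
  have fin: "finite (states M)"
    using M by (simp add: pebble_automaton_def)
  have st: "state (R n) \<in> states M" "carried (R n) \<in> {0, 1}" for n
    using legal[of n] by (auto simp: legal_def)
  have "\<exists>i j w. i < j \<and> (\<forall>n. pos (R (j + n)) = pos (R (i + n)) + w)"
  proof (cases "infinite {n. at_pebble (R n)}")
    case True
    have sub: "(\<lambda>n. (state (R n), carried (R n))) ` {n. at_pebble (R n)} \<subseteq> states M \<times> {0, 1}"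
      using st by blast
    obtain i j where ij: "at_pebble (R i)" "at_pebble (R j)" "i < j"
      "(state (R i), carried (R i)) = (state (R j), carried (R j))"
      using infinite_repetition[OF True _ sub] fin by (metis finite.emptyI finite.insertI finite_cartesian_product mem_Collect_eq)
    define w where "w = pos (R j) - pos (R i)"
    have "R j = shift w (R i)"
      unfolding w_def by (rule at_pebble_shift[OF legal legal]) (use ij in auto)
    then have "R (j + n) = shift w (R (i + n))" for n
      using run_shift[of "{}" M "R i" w n] unfolding R_add[symmetric] by simp
    then show ?thesis
      using ij(3) by (metis shift_simps(1))
  next
    case False
    \<comment> \<open>From time \<open>k\<close> on the pebble is neither carried nor met, so a
      repeated state after \<open>k\<close> is enough.\<close>
    then obtain k where k: "\<And>n. k \<le> n \<Longrightarrow> \<not> at_pebble (R n)"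
      by (metis finite_nat_set_iff_bounded mem_Collect_eq linorder_not_less)
    obtain i j where ij: "k \<le> i" "k \<le> j" "i < j" "state (R i) = state (R j)"
      by (rule infinite_repetition[OF infinite_Ici[of k] fin, of "\<lambda>n. state (R n)"]) (use st in auto)
    have "pos (R (j + n)) = pos (R (i + n)) + (pos (R j) - pos (R i))" for n
      using lone_run[OF M legal legal, of i j "pos (R j) - pos (R i)" n] ij k
      by (simp add: R_add)
    then show ?thesis
      using ij(3) by blast
  qed
  then obtain i j w where ij: "i < j" and eq: "\<And>n. pos (R (j + n)) = pos (R (i + n)) + w"
    by blast
  show ?thesis
  proof (rule that[of "j - i" i w])
    fix n assume "i \<le> n"
    then show "pos (R (n + (j - i))) = pos (R n) + w"
      using eq[of "n - i"] ij by (simp add: add.commute)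
  qed (use ij in simp)
qed

text \<open>Subtracting the mean velocity \<open>w / of_nat \<tau>\<close> leaves a function that is
  periodic from \<open>i\<close> on; it takes only its values before \<open>i + \<tau>\<close>, and
  \<open>K\<close> is the largest of their norms.\<close>

lemma periodic_linear_drift:
  fixes f :: "nat \<Rightarrow> complex"
  assumes "0 < \<tau>" "\<And>n. i \<le> n \<Longrightarrow> f (n + \<tau>) = f n + w"
  obtains v K where "\<And>n. norm (f n - of_nat n * v) \<le> K"
proof -
  define v where "v = w / of_nat \<tau>"
  define g where "g n = f n - of_nat n * v" for n
  have per: "g (n + \<tau>) = g n" if "i \<le> n" for n
    using assms(1) assms(2)[OF that] by (simp add: g_def v_def field_simps)
  have "g n \<in> g ` {..<i + \<tau>}" for n
  proof (induction n rule: less_induct)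
    case (less n)
    show ?case
    proof (cases "n < i + \<tau>")
      case False
      then have "g n = g (n - \<tau>)" "n - \<tau> < n"
        using per[of "n - \<tau>"] assms(1) by auto
      then show ?thesis
        using less by metis
    qed simp
  qed
  then have "norm (g n) \<le> Max (norm ` g ` {..<i + \<tau>})" for n
    by (intro Max_ge) auto
  then show ?thesis
    using that unfolding g_def by blast
qed

lemma free_run_drift:
  assumes "pebble_automaton 1 M" "legal M C"
  obtains v K where "\<And>n. norm (point (pos ((step M {} ^^ n) C)) - of_nat n * v) \<le> K"
proof -
  obtain i \<tau> w where per: "0 < \<tau>"
    "\<And>n. i \<le> n \<Longrightarrow> pos ((step M {} ^^ (n + \<tau>)) C) = pos ((step M {} ^^ n) C) + w"
    by (rule free_run_eventually_periodic[OF assms]) (rule that)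
  have "point (pos ((step M {} ^^ (n + \<tau>)) C)) = point (pos ((step M {} ^^ n) C)) + point w"
    if "i \<le> n" for n
    using per(2)[OF that] point_add by simp
  then obtain v K where "\<And>n. norm (point (pos ((step M {} ^^ n) C)) - of_nat n * v) \<le> K"
    using periodic_linear_drift[OF per(1), of i "\<lambda>n. point (pos ((step M {} ^^ n) C))" "point w"]
    by blast
  then show ?thesis
    using that by blast
qed

section \<open>Geometry of the wall\<close>

text \<open>Coordinates in which \<open>H1\<close> is the nonnegative first axis; the second axis points to the
  clockwise side of \<open>H1\<close>.\<close>

definition along :: "real \<Rightarrow> complex \<Rightarrow> real" where
  "along \<theta> z = Re (z * cis (- \<theta>))"

definition across :: "real \<Rightarrow> complex \<Rightarrow> real" where
  "across \<theta> z = - Im (z * cis (- \<theta>))"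

lemma along_linear:
  "along \<theta> (x + y) = along \<theta> x + along \<theta> y" "along \<theta> (x - y) = along \<theta> x - along \<theta> y"
  "along \<theta> (of_real r * x) = r * along \<theta> x"
  by (simp_all add: along_def algebra_simps)

lemma across_linear:
  "across \<theta> (x + y) = across \<theta> x + across \<theta> y" "across \<theta> (x - y) = across \<theta> x - across \<theta> y"
  "across \<theta> (of_real r * x) = r * across \<theta> x"
  by (simp_all add: across_def algebra_simps)

lemma abs_along_le: "\<bar>along \<theta> z\<bar> \<le> norm z"
  using abs_Re_le_cmod[of "z * cis (- \<theta>)"] by (simp add: along_def norm_mult)

lemma abs_across_le: "\<bar>across \<theta> z\<bar> \<le> norm z"
  using abs_Im_le_cmod[of "z * cis (- \<theta>)"] by (simp add: across_def norm_mult)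

lemma rcis_along_across: "along \<theta> (rcis r \<theta>) = r \<and> across \<theta> (rcis r \<theta>) = 0"
proof -
  have "rcis r \<theta> * cis (- \<theta>) = of_real r"
    by (simp add: rcis_def mult.assoc cis_mult)
  then show ?thesis
    by (simp add: along_def across_def)
qed

text \<open>The points on the clockwise side of the first half-line are at a clockwise angle between
  0 and \<open>pi\<close> from it.\<close>

lemma half_plane_subset_region:
  assumes "pi \<le> \<alpha>" "0 \<le> across \<theta> (z - c)"
  shows "z \<in> region c \<theta> \<alpha>"
proof -
  \<comment> \<open>Rotating the half-line onto the positive real axis and conjugating turns the
    clockwise angle into \<open>Arg w\<close>.\<close>
  define w where "w = cnj ((z - c) * cis (- \<theta>))"
  have im: "0 \<le> Im w"
    using assms(2) by (simp only: w_def across_def cnj.simps)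
  have t: "Arg w \<in> {0..\<alpha>}"
    using im assms(1) Arg_bounded[of w] Arg_less_0[of w] by auto
  have "cnj w = rcis (norm w) (- Arg w)"
    by (metis cis_cnj complex_cnj_complex_of_real complex_cnj_mult rcis_cmod_Arg rcis_def)
  moreover have "cnj w = (z - c) * cis (- \<theta>)"
    unfolding w_def by (rule complex_cnj_cnj)
  ultimately have "(z - c) * cis (- \<theta>) = rcis (norm w) (- Arg w)"
    by simp
  then have "z - c = rcis (norm w) (- Arg w) * cis \<theta>"
    by (metis (no_types, lifting) cis_mult cis_zero mult.assoc mult.right_neutral add.left_inverse)
  then have "z = c + rcis (norm w) (\<theta> - Arg w)"
    by (simp add: rcis_def cis_mult algebra_simps)
  then show ?thesis
    using t unfolding region_def half_line_def by fastforce
qed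

text \<open>Edges crossing neither half-line, or only the second, are free; an edge crossing both
  also crosses the first.\<close>

lemma blocked_imp_crossing:
  assumes "semi_walled B c \<theta> \<alpha>" "e \<in> B"
  shows "e \<in> crossing_edges (wedge c \<theta> \<alpha>) (half_line c \<theta>)"
  using assms
  unfolding semi_walled_def Let_def is_free_def first_half_line_def second_half_line_def by blast

lemma crossing_edge_meets:
  assumes "{u, v} \<in> crossing_edges V H"
  shows "H \<inter> closed_segment (point u) (point v) \<noteq> {}"
  using assms unfolding crossing_edges_def by (auto simp: doubleton_eq_iff closed_segment_commute)

text \<open>A blocked edge has length 1 and meets the first half-line, so both its ends are within
  distance 1 of it.\<close>

lemma blocked_port_near_wall:
  assumes "semi_walled B c \<theta> \<alpha>" "free_ports B u \<noteq> UNIV"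
  shows "\<bar>across \<theta> (point u - c)\<bar> \<le> 1" "- 1 \<le> along \<theta> (point u - c)"
proof -
  obtain d where "{u, neighbour u d} \<in> B"
    using assms(2) by (auto simp: free_ports_def)
  then obtain h where h: "h \<in> half_line c \<theta>" "h \<in> closed_segment (point u) (point (neighbour u d))"
    using crossing_edge_meets blocked_imp_crossing[OF assms(1)] by blast
  obtain r where r: "0 \<le> r" "h = c + rcis r \<theta>"
    using h(1) by (auto simp: half_line_def)
  have "norm (point u - h) \<le> 1"
    using segment_bound(1)[OF h(2)] norm_neighbour[of u d] by (simp add: norm_minus_commute)
  then have "\<bar>across \<theta> (point u - h)\<bar> \<le> 1" "\<bar>along \<theta> (point u - h)\<bar> \<le> 1"
    using abs_across_le[of \<theta> "point u - h"] abs_along_le[of \<theta> "point u - h"] by linarith+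
  moreover have "point u - h = (point u - c) - rcis r \<theta>"
    using r(2) by simp
  then have "across \<theta> (point u - h) = across \<theta> (point u - c)"
    "along \<theta> (point u - h) = along \<theta> (point u - c) - r"
    using rcis_along_across[of \<theta> r] by (simp_all only: along_linear(2) across_linear(2))
  ultimately show "\<bar>across \<theta> (point u - c)\<bar> \<le> 1" "- 1 \<le> along \<theta> (point u - c)"
    using r(1) by linarith+
qed

section \<open>A cone from which the wall is never met\<close>

text \<open>\<open>A\<close> bounds the slope of the drift relative to the wall. The margin
  \<open>K + 1\<close> covers the deviation \<open>K\<close> from the drift line and the distance 1
  between the wall and its blocked ports.\<close>

definition thin_cone :: "complex \<Rightarrow> real \<Rightarrow> real \<Rightarrow> real \<Rightarrow> complex set" where
  "thin_cone c \<theta> A K = {z. K + 1 < across \<theta> (z - c) \<and>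
     along \<theta> (z - c) < - (K + 1) - A * (across \<theta> (z - c) + K + 1)}"

lemma thin_cone_in_wedge:
  assumes "large \<alpha>" "0 \<le> K" "point u \<in> thin_cone c \<theta> A K"
  shows "u \<in> wedge c \<theta> \<alpha>"
  using assms half_plane_subset_region[of \<alpha> \<theta> "point u" c]
  by (simp add: wedge_def thin_cone_def large_def)

text \<open>Coming within \<open>K\<close> of \<open>w\<close> changes the \<open>across\<close>
  coordinate by at most \<open>across \<theta> (x - c) + K + 1\<close> along the line, hence the
  \<open>along\<close> coordinate by at most \<open>A\<close> times that. From the cone this falls
  short of -1, even with the extra \<open>K\<close>.\<close>

lemma no_line_through_cone_and_wall:
  assumes x: "x \<in> thin_cone c \<theta> A K" and A: "\<bar>along \<theta> v\<bar> \<le> A * \<bar>across \<theta> v\<bar> \<or> across \<theta> v = 0"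
    and "0 \<le> A" and w: "\<bar>across \<theta> (w - c)\<bar> \<le> 1" "- 1 \<le> along \<theta> (w - c)"
  shows "K < norm (w - x - of_real r * v)"
proof (rule ccontr)
  assume "\<not> ?thesis"
  then have le: "norm (w - x - of_real r * v) \<le> K"
    by simp
  have e: "w - x - of_real r * v = (w - c) - (x - c) - of_real r * v"
    by simp
  have acr: "\<bar>across \<theta> (w - c) - across \<theta> (x - c) - r * across \<theta> v\<bar> \<le> K"
    using order_trans[OF abs_across_le le, of \<theta>] by (simp only: e across_linear)
  have alo: "\<bar>along \<theta> (w - c) - along \<theta> (x - c) - r * along \<theta> v\<bar> \<le> K"
    using order_trans[OF abs_along_le le, of \<theta>] by (simp only: e along_linear)
  have X: "K + 1 < across \<theta> (x - c)"
    "along \<theta> (x - c) < - (K + 1) - A * (across \<theta> (x - c) + K + 1)"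
    using x by (simp_all add: thin_cone_def)
  \<comment> \<open>The \<open>across\<close> coordinates of \<open>x\<close> and \<open>w\<close>
    differ by more than \<open>K\<close>; this excludes a drift parallel to the wall.\<close>
  have "r * across \<theta> v \<noteq> 0"
    using acr X w by linarith
  then have a: "\<bar>along \<theta> v\<bar> \<le> A * \<bar>across \<theta> v\<bar>"
    using A by auto
  have "\<bar>r * along \<theta> v\<bar> \<le> A * \<bar>r * across \<theta> v\<bar>"
    using mult_left_mono[OF a, of "\<bar>r\<bar>"] by (simp add: abs_mult mult.left_commute)
  also have "\<dots> \<le> A * (across \<theta> (x - c) + K + 1)"
    by (rule mult_left_mono) (use acr w X \<open>0 \<le> A\<close> in linarith)+
  finally show False
    using alo X w by linarith
qed

lemma ex_node_near: "\<exists>u. norm (point u - z) \<le> 1"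
proof -
  let ?u = "(round (Re z), round (Im z))"
  have "norm (point ?u - z) \<le> \<bar>Re (point ?u - z)\<bar> + \<bar>Im (point ?u - z)\<bar>"
    by (rule cmod_le)
  also have "\<dots> \<le> 1/2 + 1/2"
    using of_int_round_abs_le[of "Re z"] of_int_round_abs_le[of "Im z"]
    by (intro add_mono) (simp_all add: point_def)
  finally show ?thesis
    by auto
qed

text \<open>The ray recedes along the wall \<open>p\<close> times as fast as it moves away across
  it, and \<open>p\<close> exceeds the slope \<open>A\<close> by at least 1. The bound on
  \<open>R\<close> absorbs the margins of the cone and the rounding error 1.\<close>

lemma ex_node_in_thin_cone:
  assumes "0 \<le> A" "0 \<le> K" "A + 1 \<le> p" "(K + 2) * (A + 1) < R"
  shows "\<exists>u. point u \<in> thin_cone c \<theta> A K \<and>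
             norm (point u - (c + of_real R * (cis \<theta> * Complex (- p) (- 1)))) \<le> 1"
proof -
  define e where "e = cis \<theta> * Complex (- p) (- 1)"
  obtain u where u: "norm (point u - (c + of_real R * e)) \<le> 1"
    using ex_node_near by blast
  have "e * cis (- \<theta>) = Complex (- p) (- 1) * (cis \<theta> * cis (- \<theta>))"
    by (simp only: e_def ac_simps)
  then have "e * cis (- \<theta>) = Complex (- p) (- 1)"
    by (simp add: cis_mult)
  then have e: "along \<theta> e = - p" "across \<theta> e = 1"
    by (simp_all add: along_def across_def)
  have s: "point u - (c + of_real R * e) = (point u - c) - of_real R * e"
    by simp
  have 1: "\<bar>across \<theta> (point u - c) - R\<bar> \<le> 1"
    using order_trans[OF abs_across_le u, of \<theta>] unfolding s across_linear by (simp add: e)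
  have 2: "\<bar>along \<theta> (point u - c) + R * p\<bar> \<le> 1"
    using order_trans[OF abs_along_le u, of \<theta>] unfolding s along_linear by (simp add: e)
  have "K + 2 \<le> (K + 2) * (A + 1)"
    using assms by (simp add: algebra_simps)
  then have R: "K + 2 < R"
    using assms by linarith
  have "R * (A + 1) \<le> R * p"
    using assms R by (intro mult_left_mono) auto
  moreover have "A * (across \<theta> (point u - c) + K + 1) \<le> A * (R + 1 + K + 1)"
    using assms 1 by (intro mult_left_mono) auto
  ultimately have "point u \<in> thin_cone c \<theta> A K"
    using 1 2 R assms by (auto simp: thin_cone_def algebra_simps)
  then show ?thesis
    using u unfolding e_def by blast
qed

text \<open>The cone has nodes arbitrarily far out in two independent directions, while a strip of
  bounded width is unbounded in at most one.\<close>

lemma thin_cone_not_in_strip: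
  assumes "0 \<le> A" "0 \<le> K"
  shows "\<exists>u. point u \<in> thin_cone c \<theta> A K \<and> (\<forall>r. L < norm (point u - of_real r * v))"
proof (rule ccontr)
  assume "\<not> ?thesis"
  then have strip: "\<exists>r. norm (point u - of_real r * v) \<le> L" if "point u \<in> thin_cone c \<theta> A K" for u
    using that by (meson linorder_not_less)
  \<comment> \<open>For \<open>v = 0\<close> the strip is a disc; the substitute 1 keeps
    \<open>g\<close> a nonzero functional that vanishes at \<open>v\<close>.\<close>
  define v' where "v' = (if v = 0 then 1 else v)"
  have v': "v' \<noteq> 0"
    by (simp add: v'_def)
  define g where "g z = Im (cnj v' * z)" for z
  have g_le: "\<bar>g z\<bar> \<le> norm v' * norm z" for z
    using abs_Im_le_cmod[of "cnj v' * z"] by (simp add: g_def norm_mult)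
  have g_lin: "g (x + y) = g x + g y" "g (x - y) = g x - g y" "g (of_real r * x) = r * g x" for x y r
    by (simp_all add: g_def algebra_simps)
  have g_v: "g v = 0"
    by (simp add: g_def v'_def)
  \<comment> \<open>On the strip \<open>g\<close> is bounded by \<open>norm v' * L\<close>, but
    along a ray it grows linearly unless it vanishes on the direction.\<close>
  have zero: "g (cis \<theta> * Complex (- p) (- 1)) = 0" if p: "A + 1 \<le> p" for p
  proof (rule ccontr)
    define e where "e = cis \<theta> * Complex (- p) (- 1)"
    assume "g (cis \<theta> * Complex (- p) (- 1)) \<noteq> 0"
    then have ne: "0 < \<bar>g e\<bar>"
      by (simp add: e_def)
    define T where "T = (norm v' * (L + 1) + \<bar>g c\<bar>) / \<bar>g e\<bar>"
    define R where "R = max T ((K + 2) * (A + 1)) + 1"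
    have R: "(K + 2) * (A + 1) < R"
      by (simp add: R_def)
    obtain u where u: "point u \<in> thin_cone c \<theta> A K" "norm (point u - (c + of_real R * e)) \<le> 1"
      using ex_node_in_thin_cone[OF assms p, of R c \<theta>] unfolding e_def[symmetric]
      using R by blast
    obtain r where r: "norm (point u - of_real r * v) \<le> L"
      using strip u(1) by blast
    have "c + of_real R * e - of_real r * v = (point u - of_real r * v) - (point u - (c + of_real R * e))"
      by simp
    then have "norm (c + of_real R * e - of_real r * v) \<le> L + 1"
      using r u(2) norm_triangle_ineq4 by (metis add_mono order_trans)
    then have "\<bar>g (c + of_real R * e - of_real r * v)\<bar> \<le> norm v' * (L + 1)"
      by (meson g_le mult_left_mono norm_ge_zero order_trans)
    then have "\<bar>g c + R * g e\<bar> \<le> norm v' * (L + 1)"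
      by (simp add: g_lin g_v)
    then have "\<bar>R\<bar> * \<bar>g e\<bar> \<le> norm v' * (L + 1) + \<bar>g c\<bar>"
      unfolding abs_mult[symmetric] by linarith
    then have "\<bar>R\<bar> \<le> T"
      using ne by (simp add: T_def field_simps)
    then show False
      by (simp add: R_def)
  qed
  \<comment> \<open>The directions for \<open>A + 1\<close> and \<open>A + 2\<close> span the plane,
    so \<open>g\<close> vanishes at \<open>cis \<theta>\<close> and
    \<open>cis \<theta> * \<i>\<close>. These values are the imaginary and real parts of
    \<open>cnj v' * cis \<theta>\<close>.\<close>
  have "cis \<theta> = cis \<theta> * Complex (- (A + 1)) (- 1) - cis \<theta> * Complex (- (A + 2)) (- 1)"
    by (simp add: complex_eq_iff algebra_simps)
  then have 1: "g (cis \<theta>) = 0"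
    using zero[of "A + 1"] zero[of "A + 2"] by (metis g_lin(2) add_left_mono diff_self one_le_numeral order_refl)
  have "cis \<theta> * \<i> = - (cis \<theta> * Complex (- (A + 1)) (- 1)) - of_real (A + 1) * cis \<theta>"
    by (simp add: complex_eq_iff algebra_simps)
  then have 2: "g (cis \<theta> * \<i>) = 0"
    using zero[of "A + 1"] 1 g_lin(2)[of 0] by (simp add: g_lin(2,3)) (simp add: g_def)
  have "cnj v' * cis \<theta> = 0"
    using 1 2 by (simp add: g_def complex_eq_iff)
  then show False
    using v' by (metis cis_neq_zero complex_cnj_zero_iff mult_eq_0_iff)
qed

section \<open>Choice of a start and of a node that is never visited\<close>

theorem theorem9:
  fixes c :: complex and \<theta> \<alpha> :: real and B :: "node set set"
  assumes "large \<alpha>" and "semi_walled B c \<theta> \<alpha>"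
  shows "\<not> (\<exists>M :: 's automaton. pebble_automaton 1 M \<and> explores 1 M B (wedge c \<theta> \<alpha>))"
proof
  assume "\<exists>M :: 's automaton. pebble_automaton 1 M \<and> explores 1 M B (wedge c \<theta> \<alpha>)"
  then obtain M :: "'s automaton" where M: "pebble_automaton 1 M"
    and ex: "explores 1 M B (wedge c \<theta> \<alpha>)"
    by blast
  \<comment> \<open>The free run from the origin fixes \<open>v\<close> and \<open>K\<close> before
    the start \<open>s\<close> is chosen.\<close>
  define F where "F n = (step M {} ^^ n) (start 1 M 0)" for n
  have "legal M (start 1 M 0)"
    using M by (simp add: legal_def start_def pebble_automaton_def)
  then obtain v K where drift: "\<And>n. norm (point (pos (F n)) - of_nat n * v) \<le> K"
    using free_run_drift[OF M] unfolding F_def by blast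
  have K: "0 \<le> K"
    using order_trans[OF norm_ge_zero drift] .
  \<comment> \<open>If \<open>across \<theta> v = 0\<close>, division by zero gives
    \<open>A = 0\<close>, and the second alternative below holds.\<close>
  define A where "A = \<bar>along \<theta> v\<bar> / \<bar>across \<theta> v\<bar>"
  have A: "0 \<le> A" "\<bar>along \<theta> v\<bar> \<le> A * \<bar>across \<theta> v\<bar> \<or> across \<theta> v = 0"
    by (auto simp: A_def)
  obtain s where s: "point s \<in> thin_cone c \<theta> A K"
    using thin_cone_not_in_strip[OF A(1) K] by blast
  define R where "R n = (step M B ^^ n) (start 1 M s)" for n
  have start: "start 1 M s = shift s (start 1 M 0)"
    by (simp add: start_def shift_def)
  have free: "free_ports B (pos (F n) + s) = UNIV" for n
  proof (rule ccontr)
    assume "free_ports B (pos (F n) + s) \<noteq> UNIV"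
    from no_line_through_cone_and_wall[OF s A(2,1) blocked_port_near_wall[OF assms(2) this], of "of_nat n"]
    show False
      using drift[of n] by (simp add: point_add)
  qed
  have R: "R n = shift s (F n)" for n
    unfolding R_def F_def start by (rule run_shift[OF free[unfolded F_def]])
  \<comment> \<open>The agent stays within \<open>K\<close> of the line through \<open>s\<close> in
    direction \<open>v\<close>, hence within \<open>K + norm (point s)\<close> of the parallel line
    through the origin.\<close>
  obtain u where u: "point u \<in> thin_cone c \<theta> A K"
    "\<And>r. K + norm (point s) < norm (point u - of_real r * v)"
    using thin_cone_not_in_strip[OF A(1) K] by metis
  obtain n where "pos (R n) = u"
    using ex thin_cone_in_wedge[OF assms(1) K] s u(1) unfolding explores_def R_def by blast
  then have "point u - of_real (of_nat n) * v = (point (pos (F n)) - of_nat n * v) + point s"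
    by (auto simp: R point_add)
  then have "norm (point u - of_real (of_nat n) * v) \<le> K + norm (point s)"
    using drift[of n] norm_triangle_ineq by (metis add_right_mono order_trans)
  then show False
    using u(2) by (meson linorder_not_less)
qed

end
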